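(* Let $\mathbb{F}$ be a finite field, let $M,N,S,\ell,K_c$ be positive integers, put $L=\ell K_c$ and $R=K_c(N+\ell-1)-N+1$, and suppose $L\le|\mathbb{F}|-S$ and $S\ge R$. Let $\Phi:V_1\times\cdots\times V_M\to W$ be a multivariate polynomial of total degree $N$, where $V_1,\dots,V_M,W$ are finite-dimensional $\mathbb{F}$-vector spaces. Then, when the data points $\mathbf{x}_1,\dots,\mathbf{x}_L\in V_1\times\cdots\times V_M$ are encoded, and the servers' answers $Y_1,\dots,Y_S\in W$ are formed, according to the $N$-CSA code for $\Phi$ (defined in the context), the evaluations $\Phi(\mathbf{x}_1),\dots,\Phi(\mathbf{x}_L)$ can be recovered from the answers of any $R=K_c(N+\ell-1)-N+1$ of the $S$ servers; that is, for every $\mathcal{R}\subset[S]$ with $|\mathcal{R}|=R$ there is a function $d_{\mathcal{R}}$ such that $d_{\mathcal{R}}((Y_s)_{s\in\mathcal{R}})=(\Phi(\mathbf{x}_l))_{l\in[L]}$ for all $\mathbf{x}_1,\dots,\mathbf{x}_L$.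
   Context: Notation: $[n]=\{1,\dots,n\}$. The data points are $\mathbf{x}_l=(x^{(1)}_l,\dots,x^{(M)}_l)$, $l\in[L]$, with $x^{(m)}_l\in V_m$; the $m$-th source holds $(x^{(m)}_l)_{l\in[L]}$. A polynomial $\Phi$ of total degree $N$ is regarded as a linear combination of restricted evaluations of $N$-linear maps: fix an expression $$\Phi(x^{(1)},\dots,x^{(M)})=\sum_{j\in[J]}\Omega_j(y_{j,1},\dots,y_{j,N}),$$ where each $\Omega_j$ is an $N$-linear map into $W$ (scalar coefficients absorbed into $\Omega_j$), and each argument $y_{j,i}$ is either one of the variables $x^{(m)}$ or the constant $1\in\mathbb{F}$ (the latter occurring for terms of degree less than $N$). The $N$-CSA code for $\Phi$. Let $f_{1,1},f_{1,2},\dots,f_{\ell,K_c},\alpha_1,\dots,\alpha_S$ be $S+L$ distinct elements of $\mathbb{F}$. For $l\in[\ell]$, $s\in[S]$ put $\Delta_s^{l,K_c}=\prod_{k\in[K_c]}(f_{l,k}-\alpha_s)$. For $m\in[M]$, $l\in[\ell]$, $k\in[K_c]$ put $x^{(m)}_{l,k}=x^{(m)}_{K_c(l-1)+k}$. The $m$-th source sends to server $s$ the share $(\widetilde{X^{(m)}}^s_1,\dots,\widetilde{X^{(m)}}^s_\ell)$ with $$\widetilde{X^{(m)}}^s_l=\Delta_s^{l,K_c}\sum_{k\in[K_c]}\frac{1}{f_{l,k}-\alpha_s}x^{(m)}_{l,k}.$$ The constant $1$ is encoded in the same way, with coded version $\Delta_s^{l,K_c}\sum_{k\in[K_c]}\frac{1}{f_{l,k}-\alpha_s}\in\mathbb{F}$.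 Let $\widetilde{y}^{\,s}_{j,i,l}$ denote $\widetilde{X^{(m)}}^s_l$ if $y_{j,i}$ is the variable $x^{(m)}$, and the coded version of $1$ if $y_{j,i}$ is the constant $1$. Server $s$ answers with $$Y_s=\sum_{j\in[J]}\sum_{l\in[\ell]}\frac{1}{\Delta_s^{l,K_c}}\,\Omega_j(\widetilde{y}^{\,s}_{j,1,l},\dots,\widetilde{y}^{\,s}_{j,N,l}).$$ *)

theory Defs
  imports Complex_Main "HOL-Library.FuncSet"
begin

(* The spaces V_1, ..., V_M are subspaces "V m" of one ambient finite-dimensional space on the
   type 'v.  Up to isomorphism this covers every finite family of finite-dimensional spaces
   (embed them in their direct sum).  Tuples are extensional functions on {1..n}. *)

definition linear_map_on ::
  "('f \<Rightarrow> 'u \<Rightarrow> 'u) \<Rightarrow> ('f \<Rightarrow> 'w \<Rightarrow> 'w) \<Rightarrow> ('u::ab_group_add) set \<Rightarrow> ('u \<Rightarrow> 'w::ab_group_add) \<Rightarrow> bool"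
where
  "linear_map_on scaleU scaleW U g \<longleftrightarrow>
     (\<forall>u\<in>U. \<forall>v\<in>U. g (u + v) = g u + g v) \<and>
     (\<forall>c. \<forall>u\<in>U. g (scaleU c u) = scaleW c (g u))"

datatype arg = Var nat | One

(* An argument slot ranges over V m if it is filled by the variable x^(m), and over the scalar
   field if it is filled by the constant 1; the sum type 'v + 'f accommodates both cases. *)

fun arg_space :: "(nat \<Rightarrow> 'v set) \<Rightarrow> arg \<Rightarrow> ('v + 'f) set" where
  "arg_space V (Var m) = Inl ` V m"
| "arg_space V One = range Inr"

definition multilinear_on ::
  "('f::field \<Rightarrow> 'v \<Rightarrow> 'v) \<Rightarrow> ('f \<Rightarrow> 'w \<Rightarrow> 'w) \<Rightarrow> (nat \<Rightarrow> ('v::ab_group_add) set) \<Rightarrow> nat \<Rightarrow>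
     (nat \<Rightarrow> arg) \<Rightarrow> ((nat \<Rightarrow> 'v + 'f) \<Rightarrow> 'w::ab_group_add) \<Rightarrow> bool"
where
  "multilinear_on scaleV scaleW V N y \<Omega> \<longleftrightarrow>
     (\<forall>a \<in> (\<Pi>\<^sub>E i\<in>{1..N}. arg_space V (y i)). \<forall>i\<in>{1..N}.
        (case y i of
           Var m \<Rightarrow> linear_map_on scaleV scaleW (V m) (\<lambda>v. \<Omega> (a(i := Inl v)))
         | One \<Rightarrow> linear_map_on (*) scaleW UNIV (\<lambda>c. \<Omega> (a(i := Inr c)))))"

fun arg_value :: "(nat \<Rightarrow> 'v) \<Rightarrow> arg \<Rightarrow> 'v + 'f::field" where
  "arg_value x (Var m) = Inl (x m)"
| "arg_value x One = Inr 1"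

definition term_degree :: "nat \<Rightarrow> (nat \<Rightarrow> arg) \<Rightarrow> nat" where
  "term_degree N y = card {i \<in> {1..N}. y i \<noteq> One}"

(* \<Phi> is the polynomial of total degree N with the expression
   \<Phi>(x) = (\<Sum>j\<in>{1..J}. \<Omega>_j(y_{j,1}, ..., y_{j,N})).
   The degree is that of the formal expression: over a finite field the function \<Phi> alone
   does not determine it. *)

definition polynomial_expression ::
  "('f::field \<Rightarrow> 'v \<Rightarrow> 'v) \<Rightarrow> ('f \<Rightarrow> 'w \<Rightarrow> 'w) \<Rightarrow> (nat \<Rightarrow> ('v::ab_group_add) set) \<Rightarrow> nat \<Rightarrow> nat \<Rightarrow>
     nat \<Rightarrow> (nat \<Rightarrow> nat \<Rightarrow> arg) \<Rightarrow> (nat \<Rightarrow> (nat \<Rightarrow> 'v + 'f) \<Rightarrow> 'w) \<Rightarrow>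
     ((nat \<Rightarrow> 'v) \<Rightarrow> 'w::ab_group_add) \<Rightarrow> bool"
where
  "polynomial_expression scaleV scaleW V M N J y \<Omega> \<Phi> \<longleftrightarrow>
     (\<forall>j\<in>{1..J}. \<forall>i\<in>{1..N}. y j i \<in> insert One (Var ` {1..M})) \<and>
     (\<forall>j\<in>{1..J}. multilinear_on scaleV scaleW V N (y j) (\<Omega> j)) \<and>
     Max (insert 0 ((\<lambda>j. term_degree N (y j)) ` {1..J})) = N \<and>
     (\<forall>x \<in> (\<Pi>\<^sub>E m\<in>{1..M}. V m).
        \<Phi> x = (\<Sum>j\<in>{1..J}. \<Omega> j (\<lambda>i\<in>{1..N}. arg_value x (y j i))))"

definition distinct_points ::
  "nat \<Rightarrow> nat \<Rightarrow> nat \<Rightarrow> (nat \<Rightarrow> nat \<Rightarrow> 'f) \<Rightarrow> (nat \<Rightarrow> 'f) \<Rightarrow> bool"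
where
  "distinct_points el Kc S f \<alpha> \<longleftrightarrow>
     inj_on (\<lambda>(l, k). f l k) ({1..el} \<times> {1..Kc}) \<and>
     inj_on \<alpha> {1..S} \<and>
     (\<forall>l\<in>{1..el}. \<forall>k\<in>{1..Kc}. \<forall>s\<in>{1..S}. f l k \<noteq> \<alpha> s)"

definition csa_Delta ::
  "(nat \<Rightarrow> nat \<Rightarrow> 'f::field) \<Rightarrow> (nat \<Rightarrow> 'f) \<Rightarrow> nat \<Rightarrow> nat \<Rightarrow> nat \<Rightarrow> 'f"
where
  "csa_Delta f \<alpha> Kc s l = (\<Prod>k\<in>{1..Kc}. f l k - \<alpha> s)"

definition csa_share ::
  "('f::field \<Rightarrow> 'u \<Rightarrow> 'u) \<Rightarrow> (nat \<Rightarrow> nat \<Rightarrow> 'f) \<Rightarrow> (nat \<Rightarrow> 'f) \<Rightarrow> nat \<Rightarrow>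
     (nat \<Rightarrow> 'u::ab_group_add) \<Rightarrow> nat \<Rightarrow> nat \<Rightarrow> 'u"
where
  "csa_share scaleU f \<alpha> Kc x s l =
     scaleU (csa_Delta f \<alpha> Kc s l)
       (\<Sum>k\<in>{1..Kc}. scaleU (1 / (f l k - \<alpha> s)) (x (Kc * (l - 1) + k)))"

(* "X l m" is the component of the data point x_l in V m. *)

fun coded_arg ::
  "('f::field \<Rightarrow> 'v \<Rightarrow> 'v) \<Rightarrow> (nat \<Rightarrow> nat \<Rightarrow> 'f) \<Rightarrow> (nat \<Rightarrow> 'f) \<Rightarrow> nat \<Rightarrow>
     (nat \<Rightarrow> nat \<Rightarrow> 'v::ab_group_add) \<Rightarrow> nat \<Rightarrow> nat \<Rightarrow> arg \<Rightarrow> 'v + 'f"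
where
  "coded_arg scaleV f \<alpha> Kc X s l (Var m) = Inl (csa_share scaleV f \<alpha> Kc (\<lambda>i. X i m) s l)"
| "coded_arg scaleV f \<alpha> Kc X s l One = Inr (csa_share (*) f \<alpha> Kc (\<lambda>_. 1) s l)"

definition csa_answer ::
  "('f::field \<Rightarrow> 'v \<Rightarrow> 'v) \<Rightarrow> ('f \<Rightarrow> 'w \<Rightarrow> 'w) \<Rightarrow> nat \<Rightarrow> nat \<Rightarrow> (nat \<Rightarrow> nat \<Rightarrow> arg) \<Rightarrow>
     (nat \<Rightarrow> (nat \<Rightarrow> 'v + 'f) \<Rightarrow> 'w) \<Rightarrow> nat \<Rightarrow> nat \<Rightarrow> (nat \<Rightarrow> nat \<Rightarrow> 'f) \<Rightarrow> (nat \<Rightarrow> 'f) \<Rightarrow>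
     (nat \<Rightarrow> nat \<Rightarrow> 'v::ab_group_add) \<Rightarrow> nat \<Rightarrow> 'w::ab_group_add"
where
  "csa_answer scaleV scaleW N J y \<Omega> el Kc f \<alpha> X s =
     (\<Sum>j\<in>{1..J}. \<Sum>l\<in>{1..el}.
        scaleW (1 / csa_Delta f \<alpha> Kc s l)
          (\<Omega> j (\<lambda>i\<in>{1..N}. coded_arg scaleV f \<alpha> Kc X s l (y j i))))"

end

theory Submission
  imports Defs "HOL-Computational_Algebra.Polynomial"
begin

text \<open>
  With P_l(z) the product of f_{l,k} - z over k, a share of block l is the value at alpha_s of a
  vector-valued polynomial of degree at most K_c - 1 which at z = f_{l,k} is a nonzero multiple of
  the data point x_{l,k}.  Applying the Omega_j gives polynomials G_l of degree at most N (K_c - 1)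
  whose values at f_{l,k} are nonzero multiples of Phi(x_{l,k}).  Clearing denominators, the answer
  Y_s times the product of all P_l(alpha_s) is the value at alpha_s of
  H = (sum over l of G_l times the product of the P_{l'} with l' different from l), whose degree is
  at most N (K_c - 1) + (el - 1) K_c = R - 1.  So any R answers determine H by Lagrange
  interpolation, and at f_{l,k} every summand of H except the l-th vanishes.
\<close>

section \<open>Lagrange interpolation of scalar polynomials\<close>

text \<open>A scalar rather than a polynomial, since it will multiply vectors of W in the
  decoder.\<close>

definition lagrange_weight :: "('i \<Rightarrow> 'f::field) \<Rightarrow> 'i set \<Rightarrow> 'i \<Rightarrow> 'f \<Rightarrow> 'f" where
  "lagrange_weight \<alpha> T s z = (\<Prod>r\<in>T - {s}. (z - \<alpha> r) / (\<alpha> s - \<alpha> r))"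

text \<open>The interpolant \<open>q\<close> and \<open>p\<close> agree at the \<open>card T\<close>
  distinct points \<alpha> s and both have degree below \<open>card T\<close>, so they are equal as
  polynomials and hence agree at every z.\<close>

lemma lagrange_interpolation:
  fixes \<alpha> :: "'i \<Rightarrow> 'f::field"
  assumes T: "finite T" "inj_on \<alpha> T" and deg: "degree p < card T"
  shows "poly p z = (\<Sum>s\<in>T. lagrange_weight \<alpha> T s z * poly p (\<alpha> s))"
proof -
  \<comment> \<open>The weights as polynomials in z, so that degrees can be bounded: each is a
    product of \<open>card T - 1\<close> factors of degree at most 1.\<close>
  define w where
    "w s = (\<Prod>r\<in>T - {s}. smult (1 / (\<alpha> s - \<alpha> r)) [:- \<alpha> r, 1:])" for s
  define q where "q = (\<Sum>s\<in>T. smult (poly p (\<alpha> s)) (w s))"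
  have poly_w: "poly (w s) x = lagrange_weight \<alpha> T s x" for s x
    unfolding w_def lagrange_weight_def poly_prod by (intro prod.cong) (auto simp: diff_divide_distrib)
  have poly_q: "poly q x = (\<Sum>s\<in>T. lagrange_weight \<alpha> T s x * poly p (\<alpha> s))" for x
    by (simp add: q_def poly_sum poly_w mult.commute)
  have weight: "lagrange_weight \<alpha> T s (\<alpha> t) = (if s = t then 1 else 0)"
    if "s \<in> T" "t \<in> T" for s t
  proof (cases "s = t")
    case True
    have "\<alpha> t \<noteq> \<alpha> r" if "r \<in> T - {t}" for r
      using that \<open>t \<in> T\<close> T(2) by (auto dest: inj_onD)
    then have "lagrange_weight \<alpha> T t (\<alpha> t) = (\<Prod>r\<in>T - {t}. 1)"
      unfolding lagrange_weight_def by (intro prod.cong) auto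
    then show ?thesis using True by simp
  next
    case False
    then show ?thesis using T(1) that unfolding lagrange_weight_def
      by (auto intro!: prod_zero bexI[of _ t])
  qed
  have "poly q (\<alpha> t) = poly p (\<alpha> t)" if "t \<in> T" for t
  proof -
    have "poly q (\<alpha> t) = (\<Sum>s\<in>T. if s = t then poly p (\<alpha> s) else 0)"
      unfolding poly_q by (intro sum.cong) (auto simp: weight that)
    then show ?thesis using that T(1) by simp
  qed
  then have eq: "poly p x = poly q x" if "x \<in> \<alpha> ` T" for x
    using that by auto
  have "degree (w s) < card T" if "s \<in> T" for s
  proof -
    have "degree (w s) \<le> (\<Sum>r\<in>T - {s}. degree (smult (1 / (\<alpha> s - \<alpha> r)) [:- \<alpha> r, 1:]))"
      unfolding w_def using degree_prod_sum_le[of "T - {s}"] T(1) unfolding o_def by blast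
    also have "\<dots> \<le> (\<Sum>r\<in>T - {s}. 1)"
      by (intro sum_mono) auto
    also have "\<dots> < card T"
      using card_Diff1_less[OF T(1) that] by (simp only: card_eq_sum)
    finally show ?thesis .
  qed
  then have "degree q < card T"
    unfolding q_def using deg by (intro degree_sum_less) (auto intro: le_less_trans[OF degree_smult_le])
  with eq have "p = q"
    using deg T by (intro poly_eqI_degree[of "\<alpha> ` T"]) (auto simp: card_image)
  then show ?thesis using poly_q[of z] by simp
qed

section \<open>Polynomial functions with vector values\<close>

text \<open>The span of the functions p(z) w with deg p \<le> n, that is, polynomial functions with
  coefficients in W. Being a predicate on functions, it asserts only that some representation of
  degree at most n exists; this is all that interpolation needs, and linear statements follow by
  induction on the rules.\<close>

inductive vector_poly ::
  "('f::field \<Rightarrow> 'w \<Rightarrow> 'w) \<Rightarrow> nat \<Rightarrow> ('f \<Rightarrow> 'w::ab_group_add) \<Rightarrow> bool"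
  for sc n where
  zero: "vector_poly sc n (\<lambda>_. 0)"
| add: "vector_poly sc n g \<Longrightarrow> vector_poly sc n h \<Longrightarrow> vector_poly sc n (\<lambda>z. g z + h z)"
| scale: "degree p \<le> n \<Longrightarrow> vector_poly sc n (\<lambda>z. sc (poly p z) w)"

lemma vector_poly_sum:
  assumes "\<And>i. i \<in> I \<Longrightarrow> vector_poly sc n (g i)"
  shows "vector_poly sc n (\<lambda>z. \<Sum>i\<in>I. g i z)"
  using assms by (induction I rule: infinite_finite_induct) (auto intro: vector_poly.intros)

lemma vector_poly_mult:
  assumes "module sc" "vector_poly sc n g" "degree p \<le> m"
  shows "vector_poly sc (n + m) (\<lambda>z. sc (poly p z) (g z))"
  using assms(2)
proof induction
  case zero
  then show ?case using module.scale_zero_right[OF assms(1)] by (simp add: vector_poly.zero)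
next
  case (add g h)
  then show ?case using module.scale_right_distrib[OF assms(1)] by (simp add: vector_poly.add)
next
  case (scale q w)
  have "degree (p * q) \<le> n + m"
    using degree_mult_le[of p q] scale assms(3) by linarith
  from vector_poly.scale[OF this, of sc w] show ?case
    by (simp add: module.scale_scale[OF assms(1)])
qed

text \<open>Both sides are additive in \<open>g\<close>, which leaves the generators p(z) w, where
  scalar interpolation of p applies.\<close>

lemma vector_poly_lagrange:
  assumes "module sc" "vector_poly sc n g" "finite T" "inj_on \<alpha> T" "n < card T"
  shows "g z = (\<Sum>s\<in>T. sc (lagrange_weight \<alpha> T s z) (g (\<alpha> s)))"
  using assms(2)
proof induction
  case zero
  then show ?case using module.scale_zero_right[OF assms(1)] by simp
next
  case (add g h)
  then show ?case
    by (simp add: module.scale_right_distrib[OF assms(1)] sum.distrib)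
next
  case (scale p w)
  then show ?case
    using lagrange_interpolation[OF assms(3,4), of p z] assms(5)
    by (simp add: module.scale_scale[OF assms(1)] module.scale_sum_left[OF assms(1)])
qed

section \<open>Multilinear maps at linear combinations of arguments\<close>

lemma linear_map_on_sum:
  assumes lin: "linear_map_on sU sW U g" and mod: "module sU" "module sW"
    and U: "module.subspace sU U" and "finite K" "\<And>k. k \<in> K \<Longrightarrow> u k \<in> U"
  shows "g (\<Sum>k\<in>K. sU (b k) (u k)) = (\<Sum>k\<in>K. sW (b k) (g (u k)))"
  using assms(5,6)
proof (induction K)
  case empty
  \<comment> \<open>Additivity at 0 yields g 0 = g 0 + g 0, hence g 0 = 0.\<close>
  have "g (0 + 0) = g 0 + g 0"
    using lin module.subspace_0[OF mod(1) U] unfolding linear_map_on_def by blast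
  then show ?case by simp
next
  case (insert k K)
  have "(\<Sum>k\<in>K. sU (b k) (u k)) \<in> U" "sU (b k) (u k) \<in> U"
    using insert by (auto intro!: module.subspace_sum[OF mod(1) U] module.subspace_scale[OF mod(1) U])
  then show ?case
    using insert lin unfolding linear_map_on_def by simp
qed

text \<open>One notation for combinations in both kinds of slot, so that coded data and the coded
  constant 1 are treated alike. The projections are meaningful when every \<open>u k\<close> carries
  the tag that the slot prescribes, as membership in \<open>arg_space\<close> ensures.\<close>

fun arg_comb ::
  "('f::field \<Rightarrow> 'v \<Rightarrow> 'v) \<Rightarrow> 'k set \<Rightarrow> ('k \<Rightarrow> 'f) \<Rightarrow> ('k \<Rightarrow> 'v + 'f) \<Rightarrow> arg \<Rightarrow>
     ('v::ab_group_add) + 'f"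
where
  "arg_comb sV K b u (Var m) = Inl (\<Sum>k\<in>K. sV (b k) (projl (u k)))"
| "arg_comb sV K b u One = Inr (\<Sum>k\<in>K. b k * projr (u k))"

lemma arg_comb_in_arg_space:
  assumes "module sV" "\<And>m. t = Var m \<Longrightarrow> module.subspace sV (V m)"
    and "\<And>k. k \<in> K \<Longrightarrow> u k \<in> arg_space V t"
  shows "arg_comb sV K b u t \<in> arg_space V t"
proof (cases t)
  case (Var m)
  then have "sV (b k) (projl (u k)) \<in> V m" if "k \<in> K" for k
    using assms(3)[OF that] module.subspace_scale[OF assms(1) assms(2)] by auto
  then show ?thesis
    using Var by (auto intro!: module.subspace_sum[OF assms(1) assms(2)])
qed auto

text \<open>Linearity in slot i alone, the other slots being frozen at \<open>a\<close>. A slot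
  holding 1 is covered by viewing the field as a module over itself.\<close>

lemma multilinear_on_arg_comb:
  assumes "multilinear_on sV sW V N y \<Omega>" and mod: "module sV" "module sW"
    and a: "a \<in> (\<Pi>\<^sub>E i\<in>{1..N}. arg_space V (y i))" and i: "i \<in> {1..N}"
    and sub: "\<And>m. y i = Var m \<Longrightarrow> module.subspace sV (V m)"
    and "finite K" and u: "\<And>k. k \<in> K \<Longrightarrow> u k \<in> arg_space V (y i)"
  shows "\<Omega> (a(i := arg_comb sV K b u (y i))) = (\<Sum>k\<in>K. sW (b k) (\<Omega> (a(i := u k))))"
proof -
  have lin: "case y i of
      Var m \<Rightarrow> linear_map_on sV sW (V m) (\<lambda>v. \<Omega> (a(i := Inl v)))
    | One \<Rightarrow> linear_map_on (*) sW UNIV (\<lambda>c. \<Omega> (a(i := Inr c)))"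
    using assms(1) a i unfolding multilinear_on_def by blast
  show ?thesis
  proof (cases "y i")
    case (Var m)
    have u': "Inl (projl (u k)) = u k" "projl (u k) \<in> V m" if "k \<in> K" for k
      using u[OF that] Var by auto
    have "\<Omega> (a(i := arg_comb sV K b u (y i))) =
        (\<Sum>k\<in>K. sW (b k) (\<Omega> (a(i := Inl (projl (u k))))))"
      using linear_map_on_sum[OF _ mod sub[OF Var] \<open>finite K\<close> u'(2)] lin
      by (simp add: Var)
    also have "\<dots> = (\<Sum>k\<in>K. sW (b k) (\<Omega> (a(i := u k))))"
      by (intro sum.cong refl) (simp only: u'(1))
    finally show ?thesis .
  next
    case One
    interpret field: module "(*) :: 'a \<Rightarrow> 'a \<Rightarrow> 'a"
      by unfold_locales (auto simp: algebra_simps)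
    have u': "Inr (projr (u k)) = u k" if "k \<in> K" for k
      using u[OF that] One by auto
    have "\<Omega> (a(i := arg_comb sV K b u (y i))) =
        (\<Sum>k\<in>K. sW (b k) (\<Omega> (a(i := Inr (projr (u k))))))"
      using linear_map_on_sum[OF _ field.module_axioms mod(2) field.subspace_UNIV \<open>finite K\<close> UNIV_I] lin
      by (simp add: One)
    also have "\<dots> = (\<Sum>k\<in>K. sW (b k) (\<Omega> (a(i := u k))))"
      by (intro sum.cong refl) (simp only: u')
    finally show ?thesis .
  qed
qed

text \<open>For hybrid tuples whose slots up to n are taken from \<open>g\<close> and whose later
  slots are taken from \<open>a\<close>: moving the border one step is a single update. By the next
  lemma an update at slot \<open>Suc n\<close> may instead be made in \<open>a\<close>, which still
  supplies that slot.\<close>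

lemma restrict_if_le_Suc:
  assumes "Suc n \<in> A"
  shows "(\<lambda>i\<in>A. if i \<le> Suc n then g i else a i) =
    (\<lambda>i\<in>A. if i \<le> n then g i else a i)(Suc n := g (Suc n))"
  using assms by (auto simp: fun_eq_iff le_Suc_eq)

lemma restrict_if_le_upd:
  assumes "Suc n \<in> A"
  shows "(\<lambda>i\<in>A. if i \<le> n then g i else a i)(Suc n := v) =
    (\<lambda>i\<in>A. if i \<le> n then g i else (a(Suc n := v)) i)"
  using assms by (auto simp: fun_eq_iff)

lemma restrict_if_in_PiE:
  assumes "\<And>i. i \<in> A \<Longrightarrow> g i \<in> B i" "\<And>i. i \<in> A \<Longrightarrow> h i \<in> B i"
  shows "(\<lambda>i\<in>A. if P i then g i else h i) \<in> (\<Pi>\<^sub>E i\<in>A. B i)"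
  using assms by auto

text \<open>Expanding the slots one after another, each expansion multiplies by coefficients
  \<open>B k\<close> of degree at most D; after N slots the degree is at most N D.\<close>

lemma multilinear_on_vector_poly:
  assumes ml: "multilinear_on sV sW V N y \<Omega>" and mod: "module sV" "module sW"
    and sub: "\<And>i m. i \<in> {1..N} \<Longrightarrow> y i = Var m \<Longrightarrow> module.subspace sV (V m)"
    and K: "finite K" and u: "\<And>i k. i \<in> {1..N} \<Longrightarrow> k \<in> K \<Longrightarrow> u i k \<in> arg_space V (y i)"
    and deg: "\<And>k. k \<in> K \<Longrightarrow> degree (B k) \<le> D"
  shows "vector_poly sW (N * D)
    (\<lambda>z. \<Omega> (\<lambda>i\<in>{1..N}. arg_comb sV K (\<lambda>k. poly (B k) z) (u i) (y i)))"
proof -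
  let ?c = "\<lambda>z i. arg_comb sV K (\<lambda>k. poly (B k) z) (u i) (y i)"
  have c: "?c z i \<in> arg_space V (y i)" if "i \<in> {1..N}" for z i
    by (rule arg_comb_in_arg_space[OF mod(1) sub[OF that] u[OF that]])
  \<comment> \<open>Hybrid argument on the number n of slots already replaced. The tuple
    \<open>a\<close> must be arbitrary in the induction, because expanding slot \<open>Suc n\<close>
    writes the vectors \<open>u (Suc n) k\<close> into it.\<close>
  have prefix: "vector_poly sW (n * D) (\<lambda>z. \<Omega> (\<lambda>i\<in>{1..N}. if i \<le> n then ?c z i else a i))"
    if "n \<le> N" "a \<in> (\<Pi>\<^sub>E i\<in>{1..N}. arg_space V (y i))" for n a
    using that
  proof (induction n arbitrary: a)
    case 0
    \<comment> \<open>With no slot replaced the function is constant, written as a multiple of the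
      polynomial 1.\<close>
    have "vector_poly sW 0 (\<lambda>z. sW (poly 1 z) (\<Omega> (\<lambda>i\<in>{1..N}. a i)))"
      by (rule vector_poly.scale) simp
    moreover have "(\<lambda>i\<in>{1..N}. if i \<le> 0 then ?c z i else a i) = (\<lambda>i\<in>{1..N}. a i)" for z
      by (intro restrict_ext) auto
    ultimately show ?case
      by (simp only: module.scale_one[OF mod(2)] poly_1 mult_0)
  next
    case (Suc n)
    then have n: "Suc n \<in> {1..N}" by simp
    let ?a = "\<lambda>z. \<lambda>i\<in>{1..N}. if i \<le> n then ?c z i else a i"
    have upd: "a(Suc n := u (Suc n) k) \<in> (\<Pi>\<^sub>E i\<in>{1..N}. arg_space V (y i))" if "k \<in> K" for k
      using Suc.prems(2) u[OF n that] n by (auto simp: PiE_iff extensional_def)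
    have "vector_poly sW (n * D + D) (\<lambda>z. \<Sum>k\<in>K. sW (poly (B k) z)
        (\<Omega> (\<lambda>i\<in>{1..N}. if i \<le> n then ?c z i else (a(Suc n := u (Suc n) k)) i)))"
    proof (rule vector_poly_sum)
      fix k assume k: "k \<in> K"
      have "n \<le> N" using Suc.prems(1) by simp
      from vector_poly_mult[OF mod(2) Suc.IH[OF this upd[OF k]] deg[OF k]]
      show "vector_poly sW (n * D + D) (\<lambda>z. sW (poly (B k) z)
        (\<Omega> (\<lambda>i\<in>{1..N}. if i \<le> n then ?c z i else (a(Suc n := u (Suc n) k)) i)))" .
    qed
    moreover have "(\<Sum>k\<in>K. sW (poly (B k) z)
        (\<Omega> (\<lambda>i\<in>{1..N}. if i \<le> n then ?c z i else (a(Suc n := u (Suc n) k)) i))) =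
      \<Omega> (\<lambda>i\<in>{1..N}. if i \<le> Suc n then ?c z i else a i)" for z
    proof -
      have a: "?a z \<in> (\<Pi>\<^sub>E i\<in>{1..N}. arg_space V (y i))"
        by (rule restrict_if_in_PiE[OF c PiE_mem[OF Suc.prems(2)]])
      have "\<Omega> (\<lambda>i\<in>{1..N}. if i \<le> Suc n then ?c z i else a i) =
          \<Omega> ((?a z)(Suc n := ?c z (Suc n)))"
        by (intro arg_cong[where f = \<Omega>] restrict_if_le_Suc n)
      also have "\<dots> = (\<Sum>k\<in>K. sW (poly (B k) z) (\<Omega> ((?a z)(Suc n := u (Suc n) k))))"
        by (rule multilinear_on_arg_comb[OF ml mod a n sub[OF n] K u[OF n]])
      also have "\<dots> = (\<Sum>k\<in>K. sW (poly (B k) z)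
        (\<Omega> (\<lambda>i\<in>{1..N}. if i \<le> n then ?c z i else (a(Suc n := u (Suc n) k)) i)))"
        by (intro sum.cong refl arg_cong2[where f = sW] arg_cong[where f = \<Omega>] restrict_if_le_upd n)
      finally show ?thesis by (rule sym)
    qed
    ultimately show ?case by (simp only: mult_Suc add.commute[of D])
  qed
  \<comment> \<open>For n = N nothing is read from \<open>a\<close>, so any element of the product
    will do; the tuple at z = 0 is one.\<close>
  have "(\<lambda>i\<in>{1..N}. ?c 0 i) \<in> (\<Pi>\<^sub>E i\<in>{1..N}. arg_space V (y i))"
    unfolding restrict_PiE_iff by (intro ballI c)
  from prefix[OF order_refl this] have "vector_poly sW (N * D)
      (\<lambda>z. \<Omega> (\<lambda>i\<in>{1..N}. if i \<le> N then ?c z i else (\<lambda>i\<in>{1..N}. ?c 0 i) i))" .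
  moreover have "(\<lambda>i\<in>{1..N}. if i \<le> N then ?c z i else (\<lambda>i\<in>{1..N}. ?c 0 i) i) =
      (\<lambda>i\<in>{1..N}. ?c z i)" for z
    by (intro restrict_ext) auto
  ultimately show ?thesis by (simp only:)
qed

text \<open>A combination over one index is a multiplication by c, so the same slot-by-slot argument
  pulls out one factor c from each of the N slots.\<close>

lemma multilinear_on_scale:
  assumes ml: "multilinear_on sV sW V N y \<Omega>" and mod: "module sV" "module sW"
    and sub: "\<And>i m. i \<in> {1..N} \<Longrightarrow> y i = Var m \<Longrightarrow> module.subspace sV (V m)"
    and u: "\<And>i. i \<in> {1..N} \<Longrightarrow> u i \<in> arg_space V (y i)"
  shows "\<Omega> (\<lambda>i\<in>{1..N}. arg_comb sV {k} (\<lambda>_. c) (\<lambda>_. u i) (y i)) =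
    sW (c ^ N) (\<Omega> (\<lambda>i\<in>{1..N}. u i))"
proof -
  let ?c = "\<lambda>i. arg_comb sV {k} (\<lambda>_. c) (\<lambda>_. u i) (y i)"
  have c: "?c i \<in> arg_space V (y i)" if "i \<in> {1..N}" for i
    by (rule arg_comb_in_arg_space[OF mod(1) sub[OF that] u[OF that]])
  have prefix: "\<Omega> (\<lambda>i\<in>{1..N}. if i \<le> n then ?c i else u i) = sW (c ^ n) (\<Omega> (\<lambda>i\<in>{1..N}. u i))"
    if "n \<le> N" for n
    using that
  proof (induction n)
    case 0
    have "(\<lambda>i\<in>{1..N}. if i \<le> 0 then ?c i else u i) = (\<lambda>i\<in>{1..N}. u i)"
      by (intro restrict_ext) auto
    then show ?case
      by (simp only: module.scale_one[OF mod(2)] power_0)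
  next
    case (Suc n)
    then have n: "Suc n \<in> {1..N}" by simp
    let ?a = "\<lambda>i\<in>{1..N}. if i \<le> n then ?c i else u i"
    have a: "?a \<in> (\<Pi>\<^sub>E i\<in>{1..N}. arg_space V (y i))"
      by (rule restrict_if_in_PiE[OF c u])
    have "\<Omega> (\<lambda>i\<in>{1..N}. if i \<le> Suc n then ?c i else u i) = \<Omega> (?a(Suc n := ?c (Suc n)))"
      by (intro arg_cong[where f = \<Omega>] restrict_if_le_Suc n)
    also have "\<dots> = (\<Sum>k\<in>{k}. sW c (\<Omega> (?a(Suc n := u (Suc n)))))"
      by (rule multilinear_on_arg_comb[OF ml mod a n sub[OF n]]) (use u[OF n] in auto)
    also have "\<dots> = sW c (\<Omega> ?a)"
    proof -
      \<comment> \<open>Slot \<open>Suc n\<close> lies beyond the border, so it already holds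
        \<open>u (Suc n)\<close>.\<close>
      have "?a(Suc n := u (Suc n)) = ?a"
        using n by (intro ext) (auto simp: restrict_def)
      then show ?thesis by (simp only:) simp
    qed
    also have "\<dots> = sW (c ^ Suc n) (\<Omega> (\<lambda>i\<in>{1..N}. u i))"
      by (simp only: Suc.IH[OF Suc_leD[OF Suc.prems]] module.scale_scale[OF mod(2)] power_Suc)
    finally show ?case .
  qed
  have "(\<lambda>i\<in>{1..N}. if i \<le> N then ?c i else u i) = (\<lambda>i\<in>{1..N}. ?c i)"
    by (intro restrict_ext) auto
  with prefix[OF order_refl] show ?thesis by (simp only:)
qed

section \<open>Shares as values of polynomials\<close>

text \<open>The factors are f k - z, not z - f k, so that on a whole block the value at \<alpha> s
  is exactly \<open>csa_Delta\<close>. The set \<open>K\<close> is a parameter because blocks with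
  one index removed are needed too.\<close>

definition node_poly :: "('k \<Rightarrow> 'f::field) \<Rightarrow> 'k set \<Rightarrow> 'f poly" where
  "node_poly f K = (\<Prod>k\<in>K. [:f k, - 1:])"

lemma poly_node_poly: "poly (node_poly f K) z = (\<Prod>k\<in>K. f k - z)"
  by (simp add: node_poly_def poly_prod)

lemma degree_node_poly_le: "degree (node_poly f K) \<le> card K"
proof (cases "finite K")
  case True
  then show ?thesis
    using degree_prod_sum_le[OF True, of "\<lambda>k. [:f k, - 1:]"] by (simp add: node_poly_def)
qed (simp add: node_poly_def)

text \<open>Delta cancels the denominator f l k - \<alpha> s, leaving the product over the other
  indices of the block.\<close>

lemma csa_share_eq:
  assumes "module sU" "\<And>k. k \<in> {1..Kc} \<Longrightarrow> f l k \<noteq> \<alpha> s"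
  shows "csa_share sU f \<alpha> Kc x s l =
    (\<Sum>k\<in>{1..Kc}. sU (poly (node_poly (f l) ({1..Kc} - {k})) (\<alpha> s)) (x (Kc * (l - 1) + k)))"
proof -
  have "csa_Delta f \<alpha> Kc s l * (1 / (f l k - \<alpha> s)) =
      poly (node_poly (f l) ({1..Kc} - {k})) (\<alpha> s)" if "k \<in> {1..Kc}" for k
    using assms(2)[OF that]
    by (simp only: csa_Delta_def poly_node_poly prod.remove[OF finite_atLeastAtMost that]) simp
  then show ?thesis
    unfolding csa_share_def
    by (auto simp: module.scale_sum_right[OF assms(1)] module.scale_scale[OF assms(1)]
        intro!: sum.cong)
qed

lemma coded_arg_eq:
  assumes "module sV" "\<And>k. k \<in> {1..Kc} \<Longrightarrow> f l k \<noteq> \<alpha> s"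
  shows "coded_arg sV f \<alpha> Kc X s l t =
    arg_comb sV {1..Kc} (\<lambda>k. poly (node_poly (f l) ({1..Kc} - {k})) (\<alpha> s))
      (\<lambda>k. arg_value (X (Kc * (l - 1) + k)) t) t"
proof (cases t)
  case One
  have "module ((*) :: 'a \<Rightarrow> 'a \<Rightarrow> 'a)"
    by unfold_locales (auto simp: algebra_simps)
  from csa_share_eq[OF this, of Kc f l \<alpha> s] show ?thesis
    using assms(2) One by simp
qed (use csa_share_eq[OF assms(1), of Kc f l \<alpha> s] assms(2) in simp)

section \<open>Decoding from R answers\<close>

theorem mainTheorem4:
  fixes M N S el Kc L R J :: nat
    and scaleV :: "'f::{field,finite} \<Rightarrow> 'v::ab_group_add \<Rightarrow> 'v"
    and scaleW :: "'f \<Rightarrow> 'w::ab_group_add \<Rightarrow> 'w"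
    and BV :: "'v set" and BW :: "'w set"
    and V :: "nat \<Rightarrow> 'v set"
    and \<Phi> :: "(nat \<Rightarrow> 'v) \<Rightarrow> 'w"
    and y :: "nat \<Rightarrow> nat \<Rightarrow> arg"
    and \<Omega> :: "nat \<Rightarrow> (nat \<Rightarrow> 'v + 'f) \<Rightarrow> 'w"
    and f :: "nat \<Rightarrow> nat \<Rightarrow> 'f"
    and \<alpha> :: "nat \<Rightarrow> 'f"
  assumes "M > 0" "N > 0" "S > 0" "el > 0" "Kc > 0"
    and "L = el * Kc"
    and "R = Kc * (N + el - 1) - N + 1"
    and "int L \<le> int (card (UNIV :: 'f set)) - int S"
    and "S \<ge> R"
    and "finite_dimensional_vector_space scaleV BV"
    and "finite_dimensional_vector_space scaleW BW"
    and "\<And>m. m \<in> {1..M} \<Longrightarrow> module.subspace scaleV (V m)"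
    and "polynomial_expression scaleV scaleW V M N J y \<Omega> \<Phi>"
    and "distinct_points el Kc S f \<alpha>"
  shows "\<forall>T. T \<subseteq> {1..S} \<and> card T = R \<longrightarrow>
    (\<exists>d :: (nat \<Rightarrow> 'w) \<Rightarrow> (nat \<Rightarrow> 'w).
      \<forall>X. (\<forall>l\<in>{1..L}. X l \<in> (\<Pi>\<^sub>E m\<in>{1..M}. V m)) \<longrightarrow>
        d (\<lambda>s\<in>T. csa_answer scaleV scaleW N J y \<Omega> el Kc f \<alpha> X s) = (\<lambda>l\<in>{1..L}. \<Phi> (X l)))"
proof (intro allI impI)
  fix T assume "T \<subseteq> {1..S} \<and> card T = R"
  then have T: "T \<subseteq> {1..S}" "card T = R" "finite T"
    using finite_subset by auto
  have modV: "module scaleV" and modW: "module scaleW"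
    using assms(10,11) unfolding finite_dimensional_vector_space_def module_iff_vector_space by auto
  have f_inj: "f l k = f l' k' \<longleftrightarrow> l = l' \<and> k = k'"
    if "l \<in> {1..el}" "k \<in> {1..Kc}" "l' \<in> {1..el}" "k' \<in> {1..Kc}" for l k l' k'
  proof -
    have "inj_on (\<lambda>(l, k). f l k) ({1..el} \<times> {1..Kc})"
      using assms(14) unfolding distinct_points_def by blast
    from inj_on_eq_iff[OF this, of "(l, k)" "(l', k')"] that show ?thesis by simp
  qed
  have f_\<alpha>: "f l k \<noteq> \<alpha> s" if "l \<in> {1..el}" "k \<in> {1..Kc}" "s \<in> T" for l k s
    using assms(14) that T unfolding distinct_points_def by auto
  have \<alpha>_inj: "inj_on \<alpha> T"
    using assms(14) T inj_on_subset unfolding distinct_points_def by blast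
  have y: "y j i = One \<or> (\<exists>m\<in>{1..M}. y j i = Var m)" if "j \<in> {1..J}" "i \<in> {1..N}" for j i
    using assms(13) that unfolding polynomial_expression_def by blast
  have ml: "multilinear_on scaleV scaleW V N (y j) (\<Omega> j)" if "j \<in> {1..J}" for j
    using assms(13) that unfolding polynomial_expression_def by blast
  have \<Phi>: "\<Phi> x = (\<Sum>j\<in>{1..J}. \<Omega> j (\<lambda>i\<in>{1..N}. arg_value x (y j i)))"
    if "x \<in> (\<Pi>\<^sub>E m\<in>{1..M}. V m)" for x
    using assms(13) that unfolding polynomial_expression_def by blast
  have sub: "module.subspace scaleV (V m)" if "j \<in> {1..J}" "i \<in> {1..N}" "y j i = Var m" for j i m
    using y[OF that(1,2)] that(3) assms(12) by auto
  have index: "Kc * (l - 1) + k \<in> {1..L}" if "l \<in> {1..el}" "k \<in> {1..Kc}" for l k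
  proof -
    have "Kc * (l - 1) + k \<le> Kc * (l - 1) + Kc" using that by simp
    also have "\<dots> = Kc * l" using that by (cases l) auto
    also have "\<dots> \<le> L" using that assms(6) by (simp add: mult.commute)
    finally show ?thesis using that by simp
  qed

  \<comment> \<open>\<open>E l k\<close> is P_l without its factor for k; \<open>Q l\<close> is the
    product of the P of all other blocks. \<open>G\<close> and \<open>H\<close> depend on the data,
    whereas \<open>gain\<close> and the decoder \<open>d\<close> below do not.\<close>
  define E where "E l k = node_poly (f l) ({1..Kc} - {k})" for l k
  define Q where "Q l = (\<Prod>l'\<in>{1..el} - {l}. node_poly (f l') {1..Kc})" for l
  define G where "G X l z = (\<Sum>j\<in>{1..J}. \<Omega> j (\<lambda>i\<in>{1..N}. arg_comb scaleV {1..Kc}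
      (\<lambda>k. poly (E l k) z) (\<lambda>k. arg_value (X (Kc * (l - 1) + k)) (y j i)) (y j i)))" for X l z
  define H where "H X z = (\<Sum>l\<in>{1..el}. scaleW (poly (Q l) z) (G X l z))" for X z
  \<comment> \<open>Inverse of the indexing t = Kc (l - 1) + k; the shifts by 1 account for l and k
    starting at 1.\<close>
  define block where "block t = (t - 1) div Kc + 1" for t
  define pos where "pos t = (t - 1) mod Kc + 1" for t
  define node where "node t = f (block t) (pos t)" for t
  \<comment> \<open>The factor with which \<Phi>(x_t) occurs in \<open>H\<close> at the node of t.
    Each of the N slots contributes one factor \<open>E\<close>, including slots holding 1, since 1
    is coded like data; thus terms of every degree share the same power.\<close>
  define gain where
    "gain t = poly (Q (block t)) (node t) * poly (E (block t) (pos t)) (node t) ^ N" for t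
  \<comment> \<open>The decoder clears denominators in the answers, interpolates \<open>H\<close> at
    the node of t, and divides by the gain.\<close>
  define d where "d Y = (\<lambda>t\<in>{1..L}. scaleW (inverse (gain t))
      (\<Sum>s\<in>T. scaleW (lagrange_weight \<alpha> T s (node t) * (\<Prod>l\<in>{1..el}. csa_Delta f \<alpha> Kc s l)) (Y s)))"
    for Y

  have block_pos: "block t \<in> {1..el}" "pos t \<in> {1..Kc}" "Kc * (block t - 1) + pos t = t"
    if "t \<in> {1..L}" for t
  proof -
    have "t - 1 < el * Kc" using that assms(6) by auto
    then show "block t \<in> {1..el}" by (simp add: block_def less_mult_imp_div_less Suc_leI)
    show "pos t \<in> {1..Kc}" using assms(5) by (simp add: pos_def Suc_leI)
    show "Kc * (block t - 1) + pos t = t"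
      using that by (simp add: block_def pos_def)
  qed
  \<comment> \<open>All factors of the gain are differences of distinct elements f l k.\<close>
  have gain_nonzero: "gain t \<noteq> 0" if "t \<in> {1..L}" for t
    using block_pos[OF that]
    by (auto simp: gain_def Q_def E_def node_def poly_prod poly_node_poly f_inj)

  have recover: "d (\<lambda>s\<in>T. csa_answer scaleV scaleW N J y \<Omega> el Kc f \<alpha> X s) = (\<lambda>t\<in>{1..L}. \<Phi> (X t))"
    if X: "\<forall>l\<in>{1..L}. X l \<in> (\<Pi>\<^sub>E m\<in>{1..M}. V m)" for X
  proof -
    have arg: "arg_value (X t) (y j i) \<in> arg_space V (y j i)"
      if "j \<in> {1..J}" "i \<in> {1..N}" "t \<in> {1..L}" for i j t
    proof -
      have "X t m \<in> V m" if "m \<in> {1..M}" for m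
        using X \<open>t \<in> {1..L}\<close> that by (blast dest: PiE_mem)
      with y[OF that(1,2)] show ?thesis by auto
    qed
    have degE: "degree (E l k) \<le> Kc - 1" if "k \<in> {1..Kc}" for l k
      using degree_node_poly_le[of "f l" "{1..Kc} - {k}"] that by (simp add: E_def)
    have degQ: "degree (Q l) \<le> (el - 1) * Kc" if "l \<in> {1..el}" for l
    proof -
      have "degree (Q l) \<le> (\<Sum>l'\<in>{1..el} - {l}. degree (node_poly (f l') {1..Kc}))"
        using degree_prod_sum_le[of "{1..el} - {l}"] by (simp add: Q_def o_def)
      also have "\<dots> \<le> (\<Sum>l'\<in>{1..el} - {l}. Kc)"
        using degree_node_poly_le[of _ "{1..Kc}"] by (intro sum_mono) simp
      finally show ?thesis using that by simp
    qed
    have "vector_poly scaleW (N * (Kc - 1)) (G X l)" if l: "l \<in> {1..el}" for l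
      unfolding G_def
    proof (rule vector_poly_sum)
      fix j assume j: "j \<in> {1..J}"
      show "vector_poly scaleW (N * (Kc - 1)) (\<lambda>z. \<Omega> j (\<lambda>i\<in>{1..N}. arg_comb scaleV {1..Kc}
          (\<lambda>k. poly (E l k) z) (\<lambda>k. arg_value (X (Kc * (l - 1) + k)) (y j i)) (y j i)))"
        by (rule multilinear_on_vector_poly[OF ml[OF j] modV modW])
          (fact sub[OF j] finite_atLeastAtMost degE arg[OF j _ index[OF l]])+
    qed
    then have "vector_poly scaleW (N * (Kc - 1) + (el - 1) * Kc) (H X)"
      unfolding H_def by (intro vector_poly_sum vector_poly_mult modW degQ)
    moreover have "N * (Kc - 1) + (el - 1) * Kc < card T"
    proof -
      \<comment> \<open>Writing both numbers as successors resolves the truncated subtractions; the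
        degree bound then equals R - 1.\<close>
      obtain e k where "el = Suc e" "Kc = Suc k"
        using assms(4,5) by (metis Suc_pred)
      then show ?thesis using T(2) assms(7) by (simp add: algebra_simps)
    qed
    ultimately have interp:
      "H X z = (\<Sum>s\<in>T. scaleW (lagrange_weight \<alpha> T s z) (H X (\<alpha> s)))" for z
      using vector_poly_lagrange[OF modW _ T(3) \<alpha>_inj] by blast

    \<comment> \<open>Multiplying 1 / Delta_l by the product of all Deltas leaves the product over
      the other blocks, which is \<open>Q l\<close> at \<alpha> s.\<close>
    have H_server: "H X (\<alpha> s) = scaleW (\<Prod>l\<in>{1..el}. csa_Delta f \<alpha> Kc s l)
        (csa_answer scaleV scaleW N J y \<Omega> el Kc f \<alpha> X s)" if s: "s \<in> T" for s
    proof -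
      have "scaleW (\<Prod>l\<in>{1..el}. csa_Delta f \<alpha> Kc s l)
          (scaleW (1 / csa_Delta f \<alpha> Kc s l)
            (\<Omega> j (\<lambda>i\<in>{1..N}. coded_arg scaleV f \<alpha> Kc X s l (y j i)))) =
        scaleW (poly (Q l) (\<alpha> s)) (\<Omega> j (\<lambda>i\<in>{1..N}. arg_comb scaleV {1..Kc}
          (\<lambda>k. poly (E l k) (\<alpha> s)) (\<lambda>k. arg_value (X (Kc * (l - 1) + k)) (y j i)) (y j i)))"
        if l: "l \<in> {1..el}" for l j
      proof -
        have "csa_Delta f \<alpha> Kc s l \<noteq> 0"
          using f_\<alpha>[OF l _ s] by (auto simp: csa_Delta_def)
        moreover have "poly (Q l) (\<alpha> s) = (\<Prod>l'\<in>{1..el} - {l}. csa_Delta f \<alpha> Kc s l')"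
          by (simp add: Q_def poly_prod poly_node_poly csa_Delta_def)
        ultimately have "(\<Prod>l\<in>{1..el}. csa_Delta f \<alpha> Kc s l) * (1 / csa_Delta f \<alpha> Kc s l) = poly (Q l) (\<alpha> s)"
          by (simp only: prod.remove[OF finite_atLeastAtMost l]) simp
        then show ?thesis
          unfolding E_def module.scale_scale[OF modW]
          using coded_arg_eq[OF modV, of Kc f l \<alpha> s X] f_\<alpha>[OF l _ s] by simp
      qed
      then show ?thesis
        unfolding H_def G_def csa_answer_def module.scale_sum_right[OF modW]
        \<comment> \<open>The answer sums over j outside and l inside, \<open>H\<close> the other
          way round.\<close>
        by (subst sum.swap) (intro sum.cong refl, simp only:)
    qed

    have H_node: "H X (node t) = scaleW (gain t) (\<Phi> (X t))" if t: "t \<in> {1..L}" for t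
    proof -
      note bp = block_pos[OF t]
      have G_node: "G X (block t) (node t) = (\<Sum>j\<in>{1..J}.
          scaleW (poly (E (block t) (pos t)) (node t) ^ N)
            (\<Omega> j (\<lambda>i\<in>{1..N}. arg_value (X t) (y j i))))"
        unfolding G_def
      proof (intro sum.cong refl)
        fix j assume j: "j \<in> {1..J}"
        define c where "c = poly (E (block t) (pos t)) (node t)"
        \<comment> \<open>For k different from \<open>pos t\<close>, \<open>E (block t) k\<close>
          keeps the factor vanishing at the node of t. Each coded argument therefore collapses to c
          times the component of x_t, or to c for the constant 1.\<close>
        have E0: "poly (E (block t) k) (node t) = (if k = pos t then c else 0)" if "k \<in> {1..Kc}" for k
          using that bp by (auto simp: c_def E_def node_def poly_node_poly intro!: bexI[of _ "pos t"])
        have "arg_comb scaleV {1..Kc} (\<lambda>k. poly (E (block t) k) (node t))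
              (\<lambda>k. arg_value (X (Kc * (block t - 1) + k)) a) a =
            arg_comb scaleV {pos t} (\<lambda>_. c) (\<lambda>_. arg_value (X t) a) a" for a
        proof (cases a)
          case (Var m)
          have "(\<Sum>k\<in>{1..Kc}. scaleV (poly (E (block t) k) (node t)) (X (Kc * (block t - 1) + k) m)) =
              (\<Sum>k\<in>{1..Kc}. if k = pos t then scaleV c (X t m) else 0)"
            using bp(3) by (intro sum.cong) (auto simp: E0 module.scale_zero_left[OF modV])
          then show ?thesis using Var bp(2) by simp
        next
          case One
          have "(\<Sum>k\<in>{1..Kc}. poly (E (block t) k) (node t)) =
              (\<Sum>k\<in>{1..Kc}. if k = pos t then c else 0)"
            by (intro sum.cong) (auto simp: E0)
          then show ?thesis using One bp(2) by simp
        qed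
        moreover have "\<Omega> j (\<lambda>i\<in>{1..N}. arg_comb scaleV {pos t} (\<lambda>_. c) (\<lambda>_. arg_value (X t) (y j i)) (y j i)) =
            scaleW (c ^ N) (\<Omega> j (\<lambda>i\<in>{1..N}. arg_value (X t) (y j i)))"
          by (rule multilinear_on_scale[OF ml[OF j] modV modW]) (fact sub[OF j] arg[OF j _ t])+
        ultimately show "\<Omega> j (\<lambda>i\<in>{1..N}. arg_comb scaleV {1..Kc} (\<lambda>k. poly (E (block t) k) (node t))
              (\<lambda>k. arg_value (X (Kc * (block t - 1) + k)) (y j i)) (y j i)) =
            scaleW (poly (E (block t) (pos t)) (node t) ^ N) (\<Omega> j (\<lambda>i\<in>{1..N}. arg_value (X t) (y j i)))"
          by (simp only: c_def)
      qed
      \<comment> \<open>\<open>Q l\<close> contains the node polynomial of \<open>block t\<close>,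
        which vanishes at the node of t.\<close>
      have "poly (Q l) (node t) = 0" if "l \<in> {1..el}" "l \<noteq> block t" for l
      proof -
        have "poly (node_poly (f (block t)) {1..Kc}) (node t) = 0"
          using bp(2) by (auto simp: poly_node_poly node_def intro!: prod_zero)
        then show ?thesis
          using that bp(1) unfolding Q_def poly_prod by (intro prod_zero) auto
      qed
      then have "H X (node t) = (\<Sum>l\<in>{1..el}. if l = block t
          then scaleW (poly (Q (block t)) (node t)) (G X (block t) (node t)) else 0)"
        unfolding H_def by (intro sum.cong) (auto simp: module.scale_zero_left[OF modW])
      also have "\<dots> = scaleW (poly (Q (block t)) (node t)) (G X (block t) (node t))"
        using bp(1) by simp
      finally show ?thesis
        by (simp only: G_node gain_def \<Phi>[OF bspec[OF X t]]
            module.scale_scale[OF modW] module.scale_sum_right[OF modW])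
    qed

    show ?thesis
    proof (unfold d_def, intro restrict_ext)
      fix t assume t: "t \<in> {1..L}"
      have "(\<Sum>s\<in>T. scaleW (lagrange_weight \<alpha> T s (node t) * (\<Prod>l\<in>{1..el}. csa_Delta f \<alpha> Kc s l))
          ((\<lambda>s\<in>T. csa_answer scaleV scaleW N J y \<Omega> el Kc f \<alpha> X s) s)) = H X (node t)"
        by (subst interp) (auto simp: H_server module.scale_scale[OF modW] intro!: sum.cong)
      then show "scaleW (inverse (gain t)) (\<Sum>s\<in>T. scaleW
          (lagrange_weight \<alpha> T s (node t) * (\<Prod>l\<in>{1..el}. csa_Delta f \<alpha> Kc s l))
          ((\<lambda>s\<in>T. csa_answer scaleV scaleW N J y \<Omega> el Kc f \<alpha> X s) s)) = \<Phi> (X t)"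
        using gain_nonzero[OF t]
        by (simp add: H_node[OF t] module.scale_scale[OF modW] module.scale_one[OF modW])
    qed
  qed
  then show "\<exists>d :: (nat \<Rightarrow> 'w) \<Rightarrow> (nat \<Rightarrow> 'w).
      \<forall>X. (\<forall>l\<in>{1..L}. X l \<in> (\<Pi>\<^sub>E m\<in>{1..M}. V m)) \<longrightarrow>
        d (\<lambda>s\<in>T. csa_answer scaleV scaleW N J y \<Omega> el Kc f \<alpha> X s) = (\<lambda>l\<in>{1..L}. \<Phi> (X l))"
    by blast
qed

end
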